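(* Let $n\ge1$ be an integer, $\nu=n+\frac12$, and let $z_1,\dots,z_n$ be the zeros of the Bessel polynomial $\theta_n(z)=\sum_{m=0}^{n}\frac{(n+m)!}{2^m(n-m)!\,m!}z^{n-m}$, listed in a fixed order. Let $\frac{1}{\tilde z_k}=\sum_{i=1}^{k-1}\frac{1}{z_i-z_k}+\sum_{i=k+1}^{n}\left(\frac{1}{z_i-z_k}-\frac{1}{z_i}\right)$, and for integers $s,a,b$ let $\zeta_{\mathcal Z}(s)=\sum_{j=1}^nz_j^{-s}$, $\zeta_{\mathcal Z}(a,b)=\sum_{n\ge n_1>n_2\ge1}z_{n_1}^{-a}z_{n_2}^{-b}$ and $\tilde\zeta_{\mathcal Z}(s)=\sum_{k=1}^n\frac{1}{\tilde z_kz_k^{s-1}}$. Then $$\frac{1}{\tilde z_k}=-1-\frac{\nu-\frac12}{z_k}-\sum_{j=k+1}^{n}\frac{1}{z_j}\quad(1\le k\le n),$$ for every integer $s$, $$\tilde\zeta_{\mathcal Z}(s)=\left(\tfrac12-\nu\right)\zeta_{\mathcal Z}(s)-\zeta_{\mathcal Z}(s-1)-\zeta_{\mathcal Z}(1,s-1),$$ for every integer $s\ge0$, $$\zeta_{\mathcal Z}(s+3)=\frac{2}{1-2\nu}\left[\zeta_{\mathcal Z}(s+2)+\sum_{\substack{a+b=s\\ a\ge-1,\ b\ge0}}\zeta_{\mathcal Z}(2+a,1+b)\right],$$ and in particular $\zeta_{\mathcal Z}(2)+\zeta_{\mathcal Z}(1)\zeta_{\mathcal Z}(2)=\left(\tfrac32-\nu\right)\zeta_{\mathcal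 Z}(3)$.
   Context: The zeros of $\theta_n$ are simple and nonzero (so the definitions make sense). *)

theory Defs
  imports Complex_Main "HOL-Computational_Algebra.Polynomial"
begin

definition bessel_theta :: "nat \<Rightarrow> complex poly" where
  "bessel_theta n =
     (\<Sum>m=0..n. monom (fact (n + m) / (2 ^ m * fact (n - m) * fact m)) (n - m))"

text \<open>
  Enumeration with multiplicities: every complex number occurs in \<open>z 1, \<dots>, z n\<close> exactly as often
  as its multiplicity as a zero of \<open>p\<close>, so simplicity of the zeros is not built in.
\<close>

definition lists_zeros :: "complex poly \<Rightarrow> nat \<Rightarrow> (nat \<Rightarrow> complex) \<Rightarrow> bool" where
  "lists_zeros p n z \<longleftrightarrow> (\<forall>w. card {k \<in> {1..n}. z k = w} = order w p)"

text \<open>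
  This is the quantity written \<open>1 / z\<close>-tilde-\<open>k\<close>. The reciprocal itself is the defined object, because
  it may vanish (for \<open>n = 1\<close> it is an empty sum).
\<close>

definition inv_ztilde :: "nat \<Rightarrow> (nat \<Rightarrow> complex) \<Rightarrow> nat \<Rightarrow> complex" where
  "inv_ztilde n z k =
     (\<Sum>i\<in>{1..<k}. 1 / (z i - z k)) + (\<Sum>i\<in>{k+1..n}. 1 / (z i - z k) - 1 / z i)"

definition zeta1 :: "nat \<Rightarrow> (nat \<Rightarrow> complex) \<Rightarrow> int \<Rightarrow> complex" where
  "zeta1 n z s = (\<Sum>j=1..n. z j powi (- s))"

definition zeta2 :: "nat \<Rightarrow> (nat \<Rightarrow> complex) \<Rightarrow> int \<Rightarrow> int \<Rightarrow> complex" where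
  "zeta2 n z a b =
     (\<Sum>(n1, n2) \<in> {(n1, n2). n \<ge> n1 \<and> n1 > n2 \<and> n2 \<ge> 1}. z n1 powi (- a) * z n2 powi (- b))"

definition zeta_tilde :: "nat \<Rightarrow> (nat \<Rightarrow> complex) \<Rightarrow> int \<Rightarrow> complex" where
  "zeta_tilde n z s = (\<Sum>k=1..n. inv_ztilde n z k * (1 / z k powi (s - 1)))"

end

theory Submission
  imports Defs "HOL-Computational_Algebra.Fundamental_Theorem_Algebra"
begin

text \<open>
  The polynomial \<open>\<theta>\<close> satisfies \<open>x \<theta>'' - 2 (x + n) \<theta>' + 2 n \<theta> = 0\<close> and does not vanish at \<open>0\<close>. Comparing
  orders of vanishing in this equation shows that its zeros are simple, and evaluating it at a zero
  gives the Stieltjes relations \<open>\<Sum>i\<noteq>k. 1 / (z i - z k) = - 1 - n / z k\<close>. The formulas for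
  \<open>1 / z\<close>-tilde-\<open>k\<close> and for the modified zeta function are restatements of these relations. Multiplying
  them by \<open>z k\<close> to the power \<open>-(s + 2)\<close>, summing over \<open>k\<close> and pairing the terms \<open>(i, k)\<close> and
  \<open>(k, i)\<close> yields the recurrence, because a divided difference of a monomial is a geometric sum.
\<close>

section \<open>Coefficients of \<open>bessel_theta\<close> and its differential equation\<close>

lemma coeff_bessel_theta:
  "coeff (bessel_theta n) k =
     (if k \<le> n then fact (2 * n - k) / (2 ^ (n - k) * fact k * fact (n - k)) else 0)"
proof -
  have "coeff (bessel_theta n) k =
      (\<Sum>m=0..n. if n - m = k then fact (n + m) / (2 ^ m * fact (n - m) * fact m) else 0)"
    unfolding bessel_theta_def coeff_sum coeff_monom ..
  also have "\<dots> = (\<Sum>m=0..n. if m = n - k \<and> k \<le> n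
      then fact (n + m) / (2 ^ m * fact (n - m) * fact m) else 0)"
    by (rule sum.cong) auto
  also have "\<dots> = (if k \<le> n then fact (2 * n - k) / (2 ^ (n - k) * fact k * fact (n - k)) else 0)"
    by (cases "k \<le> n") (simp_all add: mult_2 sum.delta)
  finally show ?thesis .
qed

text \<open>This is the differential equation read off at degree \<open>k\<close>. Free of division,
  it also covers \<open>k = n\<close>, where the factor \<open>of_nat n - of_nat k\<close> vanishes,
  and larger \<open>k\<close>, where both coefficients are zero.\<close>

lemma coeff_bessel_theta_Suc:
  "(of_nat k + 1) * (2 * of_nat n - of_nat k) * coeff (bessel_theta n) (Suc k) =
     2 * (of_nat n - of_nat k) * coeff (bessel_theta n) k"
proof (cases "k < n")
  case True
  \<comment> \<open>Writing \<open>n = k + d + 1\<close> removes natural-number subtraction from the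
    factorials.\<close>
  then obtain d where n: "n = Suc (k + d)"
    using less_imp_Suc_add by blast
  have e: "2 * n - k = Suc (Suc (k + 2 * d))" "n - k = Suc d"
    "2 * n - Suc k = Suc (k + 2 * d)" "n - Suc k = d" "Suc k \<le> n" "k \<le> n"
    using n by auto
  have nz: "(of_nat k + 1 :: complex) \<noteq> 0" "(of_nat d + 1 :: complex) \<noteq> 0"
    by (metis of_nat_Suc of_nat_eq_0_iff add.commute nat.distinct(1))+
  have f: "2 * of_nat n - of_nat k = (of_nat k + 2 * of_nat d + 2 :: complex)"
     "of_nat n - of_nat k = (of_nat d + 1 :: complex)"
    using n by auto
  have F: "(fact (Suc (Suc (k + 2 * d))) :: complex) =
      (of_nat k + 2 * of_nat d + 2) * fact (Suc (k + 2 * d))"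
    "(fact (Suc k) :: complex) = (of_nat k + 1) * fact k"
    "(fact (Suc d) :: complex) = (of_nat d + 1) * fact d"
    unfolding fact_Suc[of "Suc (k + 2 * d)"] fact_Suc[of k] fact_Suc[of d]
    by (simp_all add: algebra_simps)
  show ?thesis
    unfolding coeff_bessel_theta e(1-4) f F using e(5,6) nz
    by (simp add: divide_simps del: fact_Suc)
next
  case False
  then show ?thesis by (cases "k = n") (auto simp: coeff_bessel_theta)
qed

lemma bessel_theta_ode:
  "[:0, 1:] * pderiv (pderiv (bessel_theta n)) =
     [:2 * of_nat n, 2:] * pderiv (bessel_theta n) - smult (2 * of_nat n) (bessel_theta n)"
  (is "?L = ?R")
proof (rule poly_eqI)
  fix k
  show "coeff ?L k = coeff ?R k"
    using coeff_bessel_theta_Suc[of k n]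
    by (cases k) (auto simp: coeff_pCons coeff_pderiv algebra_simps)
qed

section \<open>Nonvanishing at the origin and simplicity of the zeros\<close>

lemma poly_bessel_theta_0: "poly (bessel_theta n) 0 \<noteq> 0"
  by (simp add: poly_0_coeff_0 coeff_bessel_theta)

lemma bessel_theta_nonzero: "bessel_theta n \<noteq> 0"
  by (metis poly_0 poly_bessel_theta_0)

lemma pderiv_nonzero_of_root:
  fixes p :: "'a::{idom,semiring_char_0} poly"
  assumes "p \<noteq> 0" "poly p a = 0"
  shows "pderiv p \<noteq> 0"
  using assms by (metis degree_eq_zeroE pCons_0_0 pderiv_eq_0_iff poly_const_conv)

text \<open>At a multiple zero \<open>w\<close>, let \<open>m\<close> be the order of the first
  derivative. As \<open>w\<close> is nonzero, the factor \<open>[:0, 1:]\<close> adds nothing and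
  the left side of the equation has order \<open>m - 1\<close>, while the right side is divisible by
  \<open>[:-w, 1:] ^ m\<close>.\<close>

lemma rsquarefree_bessel_theta: "rsquarefree (bessel_theta n)"
  unfolding rsquarefree_roots
proof (intro allI notI, elim conjE)
  fix w
  define p where "p = bessel_theta n"
  assume "poly (bessel_theta n) w = 0" "poly (pderiv (bessel_theta n)) w = 0"
  then have r: "poly p w = 0" "poly (pderiv p) w = 0"
    by (simp_all add: p_def)
  have w: "w \<noteq> 0"
    using r(1) poly_bessel_theta_0 by (auto simp: p_def)
  have p: "p \<noteq> 0"
    by (simp add: p_def bessel_theta_nonzero)
  then have p': "pderiv p \<noteq> 0"
    using r(1) by (rule pderiv_nonzero_of_root)
  then have p'': "pderiv (pderiv p) \<noteq> 0"
    using r(2) by (rule pderiv_nonzero_of_root)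
  define m where "m = order w (pderiv p)"
  have op: "order w p = Suc m"
    using order_pderiv[OF p r(1)] by (simp add: m_def)
  have op': "m = Suc (order w (pderiv (pderiv p)))"
    using order_pderiv[OF p' r(2)] by (simp add: m_def)
  have d: "[:-w, 1:] ^ m dvd pderiv p" "[:-w, 1:] ^ m dvd p"
    unfolding order_divides op m_def[symmetric] by simp_all
  have "[:-w, 1:] ^ m dvd [:2 * of_nat n, 2:] * pderiv p - smult (2 * of_nat n) p"
    by (rule dvd_diff[OF dvd_mult[OF d(1)] dvd_smult[OF d(2)]])
  then have "[:-w, 1:] ^ m dvd [:0, 1:] * pderiv (pderiv p)"
    unfolding p_def bessel_theta_ode .
  moreover have X: "[:0, 1:] * pderiv (pderiv p) \<noteq> 0"
    using p'' by simp
  ultimately have "m \<le> order w ([:0, 1:] * pderiv (pderiv p))"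
    unfolding order_divides by blast
  also have "\<dots> = order w [:0, 1:] + order w (pderiv (pderiv p))"
    by (rule order_mult[OF X])
  also have "order w [:0, 1:] = 0"
    using w by (intro order_0I) simp
  finally show False
    using op' by simp
qed

section \<open>Factorization over the zeros and the Stieltjes relations\<close>

lemma poly_pderiv_prod_linear_factors:
  fixes z :: "'b \<Rightarrow> 'a::field"
  assumes "finite A" "\<And>i. i \<in> A \<Longrightarrow> x \<noteq> z i"
  shows "poly (pderiv (\<Prod>i\<in>A. [:- z i, 1:])) x =
           (\<Sum>i\<in>A. 1 / (x - z i)) * poly (\<Prod>i\<in>A. [:- z i, 1:]) x"
proof -
  have "poly (pderiv (\<Prod>i\<in>A. [:- z i, 1:])) x = (\<Sum>i\<in>A. \<Prod>j\<in>A - {i}. x - z j)"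
    by (simp add: pderiv_prod poly_sum poly_prod pderiv_pCons)
  \<comment> \<open>Restoring the omitted factor \<open>x - z i\<close> in each term produces the
    logarithmic derivative.\<close>
  also have "\<dots> = (\<Sum>i\<in>A. 1 / (x - z i) * (\<Prod>j\<in>A. x - z j))"
  proof (rule sum.cong)
    fix i assume "i \<in> A"
    then show "(\<Prod>j\<in>A - {i}. x - z j) = 1 / (x - z i) * (\<Prod>j\<in>A. x - z j)"
      using assms by (simp add: prod.remove[of A i])
  qed simp
  finally show ?thesis
    by (simp add: sum_distrib_right poly_prod)
qed

lemma sum_remove_interval:
  fixes f :: "nat \<Rightarrow> 'a::comm_monoid_add"
  assumes "k \<in> {1..n}"
  shows "(\<Sum>i\<in>{1..n} - {k}. f i) = (\<Sum>i\<in>{1..<k}. f i) + (\<Sum>i=k+1..n. f i)"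
proof -
  have eq: "{1..n} - {k} = {1..<k} \<union> {k+1..n}"
    using assms by auto
  show ?thesis
    unfolding eq by (rule sum.union_disjoint) auto
qed

context
  fixes n :: nat and z :: "nat \<Rightarrow> complex"
  assumes zeros: "lists_zeros (bessel_theta n) n z"
begin

lemma bessel_zeros_image: "z ` {1..n} = {w. poly (bessel_theta n) w = 0}"
proof -
  have "poly (bessel_theta n) w = 0 \<longleftrightarrow> w \<in> z ` {1..n}" for w
  proof -
    have "poly (bessel_theta n) w = 0 \<longleftrightarrow> card {k \<in> {1..n}. z k = w} \<noteq> 0"
      using zeros bessel_theta_nonzero by (simp add: lists_zeros_def order_root)
    also have "\<dots> \<longleftrightarrow> w \<in> z ` {1..n}"
      by (auto simp: card_eq_0_iff)
    finally show ?thesis .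
  qed
  then show ?thesis by auto
qed

lemma bessel_zeros_nonzero: "k \<in> {1..n} \<Longrightarrow> z k \<noteq> 0"
  using bessel_zeros_image poly_bessel_theta_0 by force

text \<open>\<open>lists_zeros\<close> counts indices by multiplicity, so simplicity leaves at most
  one index per value.\<close>

lemma bessel_zeros_inj: "inj_on z {1..n}"
proof (rule inj_onI)
  fix i j assume ij: "i \<in> {1..n}" "j \<in> {1..n}" "z i = z j"
  have "card {k \<in> {1..n}. z k = z i} \<le> 1"
    using zeros rsquarefree_bessel_theta[of n]
    by (metis lists_zeros_def rsquarefree_def le_numeral_extra(4) zero_le_one)
  then show "i = j"
    using ij card_le_Suc0_iff_eq[of "{k \<in> {1..n}. z k = z i}"] by auto
qed

lemma bessel_theta_factorization:
  obtains c where "c \<noteq> 0" "bessel_theta n = smult c (\<Prod>i=1..n. [:- z i, 1:])"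
proof
  show "lead_coeff (bessel_theta n) \<noteq> 0"
    by (simp add: bessel_theta_nonzero)
  have "bessel_theta n = smult (lead_coeff (bessel_theta n)) (\<Prod>w\<in>z ` {1..n}. [:- w, 1:])"
    using complex_poly_decompose_rsquarefree[OF rsquarefree_bessel_theta[of n]]
    unfolding bessel_zeros_image by (rule sym)
  then show "bessel_theta n = smult (lead_coeff (bessel_theta n)) (\<Prod>i=1..n. [:- z i, 1:])"
    unfolding prod.reindex[OF bessel_zeros_inj] o_def .
qed

text \<open>Split off the factor \<open>l\<close> vanishing at \<open>z k\<close>, leaving
  \<open>q\<close>. The first two derivatives at \<open>z k\<close> are then \<open>c\<close> times
  \<open>q\<close> and \<open>2 * c\<close> times the derivative of \<open>q\<close>, so the
  differential equation there determines the logarithmic derivative \<open>S\<close> of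
  \<open>q\<close>.\<close>

lemma bessel_stieltjes:
  assumes k: "k \<in> {1..n}"
  shows "(\<Sum>i\<in>{1..n} - {k}. 1 / (z i - z k)) = - 1 - of_nat n / z k"
proof -
  define q where "q = (\<Prod>i\<in>{1..n} - {k}. [:- z i, 1:])"
  define S where "S = (\<Sum>i\<in>{1..n} - {k}. 1 / (z k - z i))"
  obtain c where c: "c \<noteq> 0" "bessel_theta n = smult c (\<Prod>i=1..n. [:- z i, 1:])"
    by (rule bessel_theta_factorization)
  define l where "l = [:- z k, 1:]"
  have l: "poly l (z k) = 0" "pderiv l = 1"
    by (simp_all add: l_def pderiv_pCons)
  have th: "bessel_theta n = smult c (l * q)"
    unfolding c(2) q_def l_def using k by (subst prod.remove[of _ k]) auto
  have d: "z k \<noteq> z i" if "i \<in> {1..n} - {k}" for i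
    using that k inj_onD[OF bessel_zeros_inj, of k i] by auto
  have q0: "poly q (z k) \<noteq> 0"
    using d by (auto simp: q_def poly_prod)
  have q': "poly (pderiv q) (z k) = S * poly q (z k)"
    unfolding q_def S_def by (rule poly_pderiv_prod_linear_factors) (use d in auto)
  have "poly (bessel_theta n) (z k) = 0" "poly (pderiv (bessel_theta n)) (z k) = c * poly q (z k)"
    "poly (pderiv (pderiv (bessel_theta n))) (z k) = 2 * c * poly (pderiv q) (z k)"
    unfolding th by (simp_all add: pderiv_smult pderiv_mult pderiv_add l)
  then have "z k * (2 * c * poly (pderiv q) (z k)) =
      2 * of_nat n * (c * poly q (z k)) + z k * (2 * (c * poly q (z k)))"
    using arg_cong[OF bessel_theta_ode[of n], of "\<lambda>p. poly p (z k)"] by simp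
  then have "2 * c * poly q (z k) * (z k * S) = 2 * c * poly q (z k) * (of_nat n + z k)"
    unfolding q' by (simp add: algebra_simps)
  then have "z k * S = of_nat n + z k"
    using c(1) q0 by simp
  then have "S = 1 + of_nat n / z k"
    using bessel_zeros_nonzero[OF k] by (simp add: field_simps)
  moreover have "(\<Sum>i\<in>{1..n} - {k}. 1 / (z i - z k)) = - S"
    unfolding S_def sum_negf[symmetric]
    by (rule sum.cong) (simp_all add: minus_divide_right)
  ultimately show ?thesis by simp
qed

text \<open>The fractions \<open>1 / (z i - z k)\<close> from both sums together form the Stieltjes
  sum; the corrections \<open>- 1 / z i\<close> survive as the tail.\<close>

lemma inv_ztilde_bessel:
  assumes k: "k \<in> {1..n}"
  shows "inv_ztilde n z k = - 1 - of_nat n / z k - (\<Sum>j=k+1..n. 1 / z j)"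
proof -
  have "(\<Sum>i\<in>{1..<k}. 1 / (z i - z k)) + (\<Sum>i=k+1..n. 1 / (z i - z k)) = - 1 - of_nat n / z k"
    using bessel_stieltjes[OF k] sum_remove_interval[OF k, of "\<lambda>i. 1 / (z i - z k)"] by simp
  then show ?thesis
    by (simp add: inv_ztilde_def sum_subtractf add_diff_eq)
qed

end

section \<open>Sums over pairs of indices and divided differences\<close>

lemma sum_strict_pairs:
  fixes f :: "nat \<Rightarrow> nat \<Rightarrow> 'a::comm_monoid_add"
  shows "(\<Sum>(i, j) \<in> {(i, j). n \<ge> i \<and> i > j \<and> j \<ge> 1}. f i j) = (\<Sum>i=1..n. \<Sum>j\<in>{1..<i}. f i j)"
proof -
  have "{(i, j). n \<ge> i \<and> i > j \<and> j \<ge> 1} = Sigma {1..n} (\<lambda>i. {1..<i})"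
    by auto
  then show ?thesis
    by (simp add: sum.Sigma)
qed

lemma sum_strict_pairs_swap:
  fixes f :: "nat \<Rightarrow> nat \<Rightarrow> 'a::comm_monoid_add"
  shows "(\<Sum>i=1..n. \<Sum>j\<in>{1..<i}. f i j) = (\<Sum>j=1..n. \<Sum>i=j+1..n. f i j)"
  unfolding sum.Sigma[OF finite_atLeastAtMost ballI[OF finite_atLeastLessThan]]
    sum.Sigma[OF finite_atLeastAtMost ballI[OF finite_atLeastAtMost]]
  by (rule sum.reindex_bij_witness[of _ prod.swap prod.swap]) auto

text \<open>Each unordered pair of distinct indices collects the terms of its two orderings.\<close>

lemma sum_off_diagonal:
  fixes f :: "nat \<Rightarrow> nat \<Rightarrow> 'a::comm_monoid_add"
  shows "(\<Sum>k=1..n. \<Sum>i\<in>{1..n} - {k}. f k i) = (\<Sum>k=1..n. \<Sum>i\<in>{1..<k}. f k i + f i k)"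
proof -
  have "(\<Sum>k=1..n. \<Sum>i\<in>{1..n} - {k}. f k i) =
      (\<Sum>k=1..n. (\<Sum>i\<in>{1..<k}. f k i) + (\<Sum>i=k+1..n. f k i))"
    by (intro sum.cong refl sum_remove_interval)
  also have "\<dots> = (\<Sum>k=1..n. \<Sum>i\<in>{1..<k}. f k i + f i k)"
    by (simp only: sum.distrib sum_strict_pairs_swap[of "\<lambda>k i. f i k"])
  finally show ?thesis .
qed

text \<open>The difference \<open>inverse x - inverse y\<close> equals
  \<open>(y - x) * inverse x * inverse y\<close>, so it cancels the denominator and leaves
  \<open>inverse x * inverse y\<close> times a geometric sum.\<close>

lemma divided_difference_inverse_power:
  fixes x y :: "'a::field"
  assumes "x \<noteq> 0" "y \<noteq> 0" "x \<noteq> y"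
  shows "inverse x ^ N / (y - x) + inverse y ^ N / (x - y) =
           (\<Sum>j<N. inverse x ^ (j + 1) * inverse y ^ (N - j))"
proof -
  have "inverse x ^ N / (y - x) + inverse y ^ N / (x - y) =
      (inverse x ^ N - inverse y ^ N) / (y - x)"
    using assms by (simp add: divide_simps) (simp add: algebra_simps)
  also have "\<dots> = (inverse x - inverse y) / (y - x) *
      (\<Sum>j<N. inverse y ^ (N - Suc j) * inverse x ^ j)"
    by (simp add: power_diff_sumr2)
  also have "(inverse x - inverse y) / (y - x) = inverse x * inverse y"
    using assms by (simp add: field_simps)
  also have "inverse x * inverse y * (\<Sum>j<N. inverse y ^ (N - Suc j) * inverse x ^ j) =
      (\<Sum>j<N. inverse x ^ (j + 1) * inverse y ^ (N - j))"
    unfolding sum_distrib_left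
  proof (rule sum.cong)
    fix j assume "j \<in> {..<N}"
    then have "N - j = Suc (N - Suc j)" by auto
    then show "inverse x * inverse y * (inverse y ^ (N - Suc j) * inverse x ^ j) =
        inverse x ^ (j + 1) * inverse y ^ (N - j)"
      by (simp add: mult_ac)
  qed simp
  finally show ?thesis .
qed

section \<open>Identities for the zeta sums of the zeros\<close>

lemma zeta1_of_nat: "zeta1 n z (int N) = (\<Sum>k=1..n. inverse (z k) ^ N)"
  by (simp add: zeta1_def power_int_minus power_inverse)

lemma zeta2_of_nat:
  "zeta2 n z (int a) (int b) = (\<Sum>k=1..n. \<Sum>i\<in>{1..<k}. inverse (z k) ^ a * inverse (z i) ^ b)"
  unfolding zeta2_def sum_strict_pairs by (simp add: power_int_minus power_inverse)

lemma sum_zeta2_weight: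
  assumes "s \<ge> 0"
  defines "N \<equiv> nat (s + 2)"
  shows "(\<Sum>(a, b) \<in> {(a, b). a + b = s \<and> a \<ge> - 1 \<and> b \<ge> 0}. zeta2 n z (2 + a) (1 + b)) =
           (\<Sum>j<N. zeta2 n z (int (j + 1)) (int (N - j)))"
  \<comment> \<open>The substitution is \<open>j = a + 1\<close>: the bound \<open>a = - 1\<close>
    becomes \<open>j = 0\<close>, and \<open>b \<ge> 0\<close> becomes \<open>j < N\<close>.\<close>
  by (rule sum.reindex_bij_witness[of _ "\<lambda>j. (int j - 1, s + 1 - int j)" "\<lambda>(a, b). nat (a + 1)"])
    (use assms in \<open>auto simp: N_def algebra_simps of_nat_diff intro!: arg_cong2[of _ _ _ _ "zeta2 n z"]\<close>)

text \<open>The term \<open>- of_nat n / z k\<close> raises the exponent from \<open>s - 1\<close>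
  to \<open>s\<close>. In the tail over \<open>j > k\<close> the larger index carries exponent
  \<open>1\<close>, whence \<open>zeta2 n z 1 (s - 1)\<close>.\<close>

lemma zeta_tilde_bessel:
  assumes zeros: "lists_zeros (bessel_theta n) n z"
  shows "zeta_tilde n z s = - of_nat n * zeta1 n z s - zeta1 n z (s - 1) - zeta2 n z 1 (s - 1)"
proof -
  have "zeta_tilde n z s = (\<Sum>k=1..n. - of_nat n * z k powi (- s) - z k powi (- (s - 1)) -
      (\<Sum>j=k+1..n. z j powi (- 1) * z k powi (- (s - 1))))"
    unfolding zeta_tilde_def
  proof (rule sum.cong)
    fix k assume k: "k \<in> {1..n}"
    have z0: "z k \<noteq> 0"
      by (rule bessel_zeros_nonzero[OF zeros k])
    have "z k powi (- s) = z k powi (- (s - 1)) / z k"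
      using z0 by (simp add: power_int_minus power_int_diff field_simps)
    moreover have "1 / z k powi (s - 1) = z k powi (- (s - 1))"
      by (simp only: power_int_minus inverse_eq_divide)
    moreover have "(\<Sum>j=k+1..n. z j powi (- 1) * z k powi (- (s - 1))) =
        (\<Sum>j=k+1..n. 1 / z j) * z k powi (- (s - 1))"
      unfolding sum_distrib_right by (simp add: power_int_minus inverse_eq_divide)
    ultimately show "inv_ztilde n z k * (1 / z k powi (s - 1)) =
        - of_nat n * z k powi (- s) - z k powi (- (s - 1)) -
        (\<Sum>j=k+1..n. z j powi (- 1) * z k powi (- (s - 1)))"
      unfolding inv_ztilde_bessel[OF zeros k] by (simp add: algebra_simps)
  qed simp
  then show ?thesis
    unfolding zeta1_def zeta2_def sum_strict_pairs sum_strict_pairs_swap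
    by (simp only: sum_subtractf sum_distrib_left)
qed

lemma zeta1_bessel_recurrence:
  assumes zeros: "lists_zeros (bessel_theta n) n z" and "s \<ge> 0"
  shows "- of_nat n * zeta1 n z (s + 3) = zeta1 n z (s + 2) +
           (\<Sum>(a, b) \<in> {(a, b). a + b = s \<and> a \<ge> - 1 \<and> b \<ge> 0}. zeta2 n z (2 + a) (1 + b))"
    (is "_ = _ + ?S")
proof -
  define N where "N = nat (s + 2)"
  have N: "s + 2 = int N" "s + 3 = int (Suc N)"
    using \<open>s \<ge> 0\<close> by (auto simp: N_def)
  \<comment> \<open>The Stieltjes relations enter with weight \<open>inverse (z k) ^ N\<close>,
    where \<open>N\<close> is \<open>s + 2\<close> as a natural number.\<close>
  have "(\<Sum>k=1..n. \<Sum>i\<in>{1..n} - {k}. inverse (z k) ^ N / (z i - z k)) =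
      (\<Sum>k=1..n. inverse (z k) ^ N * (- 1 - of_nat n / z k))"
    by (rule sum.cong) (simp_all add: bessel_stieltjes[OF zeros, symmetric] sum_distrib_left)
  also have "\<dots> = - zeta1 n z (s + 2) - of_nat n * zeta1 n z (s + 3)"
    unfolding N zeta1_of_nat
    by (simp add: algebra_simps divide_inverse sum_subtractf sum_negf sum_distrib_left)
  finally have "- zeta1 n z (s + 2) - of_nat n * zeta1 n z (s + 3) =
      (\<Sum>k=1..n. \<Sum>i\<in>{1..<k}. inverse (z k) ^ N / (z i - z k) + inverse (z i) ^ N / (z k - z i))"
    by (simp only: sum_off_diagonal)
  \<comment> \<open>The two terms of a pair have opposite denominators and combine into a divided
    difference.\<close>
  also have "\<dots> = (\<Sum>k=1..n. \<Sum>i\<in>{1..<k}. \<Sum>j<N. inverse (z k) ^ (j + 1) * inverse (z i) ^ (N - j))"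
  proof (intro sum.cong refl)
    fix k i assume ki: "k \<in> {1..n}" "i \<in> {1..<k}"
    then have i: "i \<in> {1..n}" by auto
    have "z k \<noteq> z i"
      using ki inj_onD[OF bessel_zeros_inj[OF zeros] _ ki(1) i] by auto
    then show "inverse (z k) ^ N / (z i - z k) + inverse (z i) ^ N / (z k - z i) =
        (\<Sum>j<N. inverse (z k) ^ (j + 1) * inverse (z i) ^ (N - j))"
      by (intro divided_difference_inverse_power bessel_zeros_nonzero[OF zeros] ki(1) i)
  qed
  also have "\<dots> = (\<Sum>j<N. zeta2 n z (int (j + 1)) (int (N - j)))"
    unfolding zeta2_of_nat by (simp only: sum.swap[of _ "{..<N}"])
  also have "\<dots> = ?S"
    unfolding N_def by (rule sum_zeta2_weight[OF \<open>s \<ge> 0\<close>, symmetric])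
  finally have "?S = - zeta1 n z (s + 2) - of_nat n * zeta1 n z (s + 3)"
    by (rule sym)
  then show ?thesis
    by simp
qed

text \<open>The product is a double sum over all index pairs: the diagonal gives the single zeta
  sum, the two orderings off it give the double ones.\<close>

lemma zeta1_mult_stuffle:
  "zeta1 n z (int a) * zeta1 n z (int b) =
     zeta1 n z (int (a + b)) + zeta2 n z (int a) (int b) + zeta2 n z (int b) (int a)"
proof -
  define f where "f k i = inverse (z k) ^ a * inverse (z i) ^ b" for k i
  have "zeta1 n z (int a) * zeta1 n z (int b) = (\<Sum>k=1..n. \<Sum>i=1..n. f k i)"
    by (simp add: zeta1_of_nat sum_product f_def)
  also have "\<dots> = (\<Sum>k=1..n. f k k + (\<Sum>i\<in>{1..n} - {k}. f k i))"
    by (intro sum.cong refl) (simp add: sum.remove)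
  also have "\<dots> = (\<Sum>k=1..n. f k k) + (\<Sum>k=1..n. \<Sum>i\<in>{1..<k}. f k i + f i k)"
    by (simp only: sum.distrib sum_off_diagonal)
  also have "\<dots> = zeta1 n z (int (a + b)) + zeta2 n z (int a) (int b) + zeta2 n z (int b) (int a)"
    unfolding zeta1_of_nat zeta2_of_nat f_def by (simp add: sum.distrib power_add mult_ac)
  finally show ?thesis .
qed

theorem theorem5p4:
  fixes n :: nat and \<nu> :: real and z :: "nat \<Rightarrow> complex"
  assumes "n \<ge> 1"
    and "\<nu> = real n + 1 / 2"
    and "lists_zeros (bessel_theta n) n z"
  shows "(\<forall>k\<in>{1..n}. inv_ztilde n z k =
            - 1 - complex_of_real (\<nu> - 1 / 2) / z k - (\<Sum>j=k+1..n. 1 / z j))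
    \<and> (\<forall>s::int. zeta_tilde n z s =
            complex_of_real (1 / 2 - \<nu>) * zeta1 n z s - zeta1 n z (s - 1) - zeta2 n z 1 (s - 1))
    \<and> (\<forall>s::int. s \<ge> 0 \<longrightarrow> zeta1 n z (s + 3) =
            complex_of_real (2 / (1 - 2 * \<nu>)) *
              (zeta1 n z (s + 2)
               + (\<Sum>(a, b) \<in> {(a, b). a + b = s \<and> a \<ge> - 1 \<and> b \<ge> 0}. zeta2 n z (2 + a) (1 + b))))
    \<and> zeta1 n z 2 + zeta1 n z 1 * zeta1 n z 2 = complex_of_real (3 / 2 - \<nu>) * zeta1 n z 3"
proof (intro conjI ballI allI impI)
  have \<nu>: "complex_of_real (\<nu> - 1 / 2) = of_nat n" "complex_of_real (1 / 2 - \<nu>) = - of_nat n"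
    "complex_of_real (3 / 2 - \<nu>) = 1 - of_nat n"
    "complex_of_real (2 / (1 - 2 * \<nu>)) = - 1 / of_nat n"
    using assms(1,2) by (simp_all add: field_simps)
  show "inv_ztilde n z k = - 1 - complex_of_real (\<nu> - 1 / 2) / z k - (\<Sum>j=k+1..n. 1 / z j)"
    if "k \<in> {1..n}" for k
    unfolding \<nu> by (rule inv_ztilde_bessel[OF assms(3) that])
  show "zeta_tilde n z s =
      complex_of_real (1 / 2 - \<nu>) * zeta1 n z s - zeta1 n z (s - 1) - zeta2 n z 1 (s - 1)" for s
    unfolding \<nu> by (rule zeta_tilde_bessel[OF assms(3)])
  show "zeta1 n z (s + 3) = complex_of_real (2 / (1 - 2 * \<nu>)) *
      (zeta1 n z (s + 2) +
       (\<Sum>(a, b) \<in> {(a, b). a + b = s \<and> a \<ge> - 1 \<and> b \<ge> 0}. zeta2 n z (2 + a) (1 + b)))"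
    if "s \<ge> 0" for s
    unfolding \<nu> zeta1_bessel_recurrence[OF assms(3) that, symmetric] using assms(1) by simp
  \<comment> \<open>For \<open>s = 0\<close> only \<open>(a, b) = (- 1, 1)\<close> and
    \<open>(0, 0)\<close> occur.\<close>
  have "- of_nat n * zeta1 n z 3 = zeta1 n z 2 + (zeta2 n z 1 2 + zeta2 n z 2 1)"
    using zeta1_bessel_recurrence[OF assms(3), of 0] sum_zeta2_weight[of 0 n z]
    by (simp add: numeral_2_eq_2)
  \<comment> \<open>The same two double sums appear here, so they can be eliminated; the extra
    \<open>zeta1 n z 3\<close> turns the factor \<open>- n\<close> into
    \<open>1 - n\<close>.\<close>
  moreover have "zeta1 n z 1 * zeta1 n z 2 = zeta1 n z 3 + zeta2 n z 1 2 + zeta2 n z 2 1"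
    using zeta1_mult_stuffle[of n z 1 2] by simp
  moreover have "(1 - of_nat n) * zeta1 n z 3 = zeta1 n z 3 + - of_nat n * zeta1 n z 3"
    by (simp add: algebra_simps)
  ultimately show
    "zeta1 n z 2 + zeta1 n z 1 * zeta1 n z 2 = complex_of_real (3 / 2 - \<nu>) * zeta1 n z 3"
    unfolding \<nu> by simp
qed

end
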